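(* Let $\bm{T}=\big(\bigotimes_{i=1}^m\Phi(\lambda_i,\alpha_i,\beta_i,\gamma_i,h_i(t_i))\big)\otimes V$ be a tensor product $\mathfrak{L}$-module as described in the context, with $\lambda_1,\ldots,\lambda_m\in\mathbb{C}^*$ pairwise distinct. Except when $m=1$ and $V$ is the $1$-dimensional trivial module, $\bm{T}$ is a new non-weight $\mathfrak{L}$-module, that is: $\bm{T}$ is not a weight module, $\bm{T}$ is not isomorphic to any irreducible restricted $\mathfrak{L}$-module, and $\bm{T}$ is not isomorphic to any module $\Phi(\lambda,\alpha,\beta,\gamma,h(t))$ with $\lambda\in\mathbb{C}^*$, $\alpha,\beta,\gamma\in\mathbb{C}$, $\alpha\neq0$ or $\beta\neq0$, and $h(t)\in\mathbb{C}[t]$.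
   Context: All vector spaces are over $\mathbb{C}$; $\mathbb{C}^*$ denotes the nonzero complex numbers, $\mathbb{Z}_+$ the nonnegative integers, $\mathbb{N}$ the positive integers. The BMS-Kac-Moody algebra $\mathfrak{L}$ is the Lie algebra with basis $\{L_m,W_m,I_m,J_m\mid m\in\mathbb{Z}\}$ and nontrivial brackets $[L_m,L_n]=(n-m)L_{m+n}$, $[L_m,W_n]=(n-m)W_{m+n}$, $[L_m,I_n]=nI_{m+n}$, $[L_m,J_n]=nJ_{m+n}$, $[W_m,I_n]=-nJ_{m+n}$ for $m,n\in\mathbb{Z}$ (all other brackets of basis elements, up to skew-symmetry, are zero). It is $\mathbb{Z}$-graded with $\mathfrak{L}_n=\mathbb{C}L_n\oplus\mathbb{C}W_n\oplus\mathbb{C}I_n\oplus\mathbb{C}J_n$. Its Cartan subalgebra (modulo center) is $\mathbb{C}L_0\oplus\mathbb{C}W_0$; a weight module is one that is the direct sum of its simultaneous eigenspaces for $L_0$ and $W_0$. For $\lambda\in\mathbb{C}^*$, $\alpha,\beta,\gamma\in\mathbb{C}$, $h(t)\in\mathbb{C}[t]$, the $\mathfrak{L}$-module $\Phi(\lambda,\alpha,\beta,\gamma,h(t))$ is the vector space $\mathbb{C}[s,t]$ with, for $f(s,t)\in\mathbb{C}[s,t]$ and $n\in\mathbb{Z}$, $L_n(f(s,t))=\lambda^n(s+h_{(n)}(t))f(s-n,t)-n\lambda^n(t-n\alpha)\frac{\partial}{\partial t}(f(s-n,t))$, $W_n(f(s,t))=\lambda^n(t-n\alpha)f(s-n,t)$,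 $I_n(f(s,t))=\lambda^n\big(\gamma-n\beta H(t)\big)f(s-n,t)+n\lambda^n\beta\frac{\partial}{\partial t}(f(s-n,t))$, $J_n(f(s,t))=\lambda^n\beta f(s-n,t)$, where $H(t)=\frac{h(t)-h(\alpha)}{t-\alpha}$ and $h_{(n)}(t)=nh(t)-n(n-1)\alpha H(t)$. An $\mathfrak{L}$-module $V$ is restricted if for every $v\in V$ there is $k\in\mathbb{Z}_+$ with $\mathfrak{L}_n\cdot v=0$ for all $n\geq k$. Tensor product module: let $m\in\mathbb{N}$. For $1\leq i\leq m$ let $\gamma_i\in\mathbb{C}$, let $\lambda_i\in\mathbb{C}^*$, $\alpha_i,\beta_i\in\mathbb{C}$ with $\alpha_i\neq0$ or $\beta_i\neq0$, and $h_i(t_i)\in\mathbb{C}[t_i]$; regard $\Phi(\lambda_i,\alpha_i,\beta_i,\gamma_i,h_i(t_i))$ as $\mathbb{C}[s_i,t_i]$. Let $V$ be an irreducible restricted $\mathfrak{L}$-module. Then $\bm{T}=\big(\bigotimes_{i=1}^m\Phi(\lambda_i,\alpha_i,\beta_i,\gamma_i,h_i(t_i))\big)\otimes V$ with the usual tensor product action. *)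

theory Defs
  imports Complex_Main
    "HOL-Computational_Algebra.Polynomial"
    "HOL-Library.Poly_Mapping"
    "HOL-Library.Cardinality"
begin

section \<open>Complex vector spaces\<close>

class scaleC =
  fixes scaleC :: "complex \<Rightarrow> 'a \<Rightarrow> 'a"  (infixr "*\<^sub>C" 75)

class complex_vector = scaleC + ab_group_add +
  assumes scaleC_add_right: "a *\<^sub>C (x + y) = a *\<^sub>C x + a *\<^sub>C y"
    and scaleC_add_left: "(a + b) *\<^sub>C x = a *\<^sub>C x + b *\<^sub>C x"
    and scaleC_scaleC: "a *\<^sub>C b *\<^sub>C x = (a * b) *\<^sub>C x"
    and scaleC_one: "1 *\<^sub>C x = x"

global_interpretation complex_vector: vector_space "scaleC :: complex \<Rightarrow> 'a \<Rightarrow> 'a::complex_vector"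
  by unfold_locales
    (use scaleC_add_right scaleC_add_left scaleC_scaleC scaleC_one in auto)

abbreviation clinear :: "('a::complex_vector \<Rightarrow> 'b::complex_vector) \<Rightarrow> bool"
  where "clinear \<equiv> Vector_Spaces.linear (*\<^sub>C) (*\<^sub>C)"

lemma clinear_iff:
  "clinear f \<longleftrightarrow> (\<forall>x y. f (x + y) = f x + f y) \<and> (\<forall>c x. f (c *\<^sub>C x) = c *\<^sub>C f x)"
  by (auto simp: linear_iff_module_hom module_hom_iff complex_vector.module_axioms)

instantiation complex :: complex_vector
begin
definition "scaleC_complex = ((*) :: complex \<Rightarrow> complex \<Rightarrow> complex)"
instance
  by standard (auto simp: scaleC_complex_def algebra_simps)
end

instantiation poly :: (complex_vector) complex_vector
begin
definition "scaleC_poly c = map_poly (scaleC c)" for c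
instance
  by standard
    (auto simp: scaleC_poly_def poly_eq_iff coeff_map_poly scaleC_add_right scaleC_add_left
      scaleC_scaleC scaleC_one)
end

instantiation poly_mapping :: (type, complex_vector) complex_vector
begin
lift_definition scaleC_poly_mapping :: "complex \<Rightarrow> ('a \<Rightarrow>\<^sub>0 'b) \<Rightarrow> 'a \<Rightarrow>\<^sub>0 'b"
  is "\<lambda>c f k. c *\<^sub>C f k"
  by (rule finite_subset[rotated]) auto
instance
  by standard
    (transfer, simp add: fun_eq_iff scaleC_add_right scaleC_add_left scaleC_scaleC scaleC_one)+
end

text \<open>The type \<open>'b \<Rightarrow>\<^sub>0 complex\<close> is the vector space with basis \<open>Poly_Mapping.single b 1\<close>.\<close>

definition lin_ext :: "('b \<Rightarrow> 'v) \<Rightarrow> ('b \<Rightarrow>\<^sub>0 complex) \<Rightarrow> 'v::complex_vector"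
  where "lin_ext g p = (\<Sum>b\<in>Poly_Mapping.keys p. Poly_Mapping.lookup p b *\<^sub>C g b)"

lemma lin_ext_superset:
  assumes "finite A" "Poly_Mapping.keys p \<subseteq> A"
  shows "lin_ext g p = (\<Sum>b\<in>A. Poly_Mapping.lookup p b *\<^sub>C g b)"
  unfolding lin_ext_def
  by (rule sum.mono_neutral_left) (use assms in \<open>auto simp: in_keys_iff\<close>)

lemma clinear_lin_ext: "clinear (lin_ext g)"
proof -
  have "lin_ext g (p + q) = lin_ext g p + lin_ext g q" for p q
  proof -
    let ?A = "Poly_Mapping.keys p \<union> Poly_Mapping.keys q"
    have "Poly_Mapping.keys (p + q) \<subseteq> ?A"
      by (rule keys_add)
    then show ?thesis
      by (simp add: lin_ext_superset[where A = ?A] lookup_add scaleC_add_left sum.distrib)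
  qed
  moreover have "lin_ext g (c *\<^sub>C p) = c *\<^sub>C lin_ext g p" for c p
  proof -
    have "Poly_Mapping.keys (c *\<^sub>C p) \<subseteq> Poly_Mapping.keys p"
      by (auto simp: in_keys_iff scaleC_poly_mapping.rep_eq)
    then show ?thesis
      by (simp add: lin_ext_superset[where A = "Poly_Mapping.keys p"] scaleC_poly_mapping.rep_eq
          complex_vector.scale_sum_right scaleC_complex_def scaleC_scaleC)
  qed
  ultimately show ?thesis
    by (simp add: clinear_iff)
qed

lemma lin_ext_single: "lin_ext g (Poly_Mapping.single b c) = c *\<^sub>C g b"
  by (simp add: lin_ext_superset[where A = "{b}"])

lemma lin_ext_unique:
  assumes "clinear F" "\<And>b. F (Poly_Mapping.single b 1) = g b"
  shows "F p = lin_ext g p"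
proof (induction p rule: update_induct)
  case const
  then show ?case
    using assms(1) by (simp add: lin_ext_def clinear_iff) (metis add_cancel_right_right add_0)
next
  case (update f a b)
  have "Poly_Mapping.update a b f = f + b *\<^sub>C Poly_Mapping.single a 1"
    using update(1)
    by (intro poly_mapping_eqI)
      (auto simp: lookup_update lookup_add lookup_single scaleC_poly_mapping.rep_eq
        scaleC_complex_def in_keys_iff when_def)
  then show ?case
    using update assms clinear_lin_ext[of g] by (simp add: clinear_iff lin_ext_single scaleC_one)
qed


section \<open>The BMS-Kac-Moody algebra\<close>

datatype bms_basis = L int | W int | I int | J int

type_synonym bms = "bms_basis \<Rightarrow>\<^sub>0 complex"

abbreviation gen :: "bms_basis \<Rightarrow> bms"
  where "gen b \<equiv> Poly_Mapping.single b 1"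

fun basis_bracket :: "bms_basis \<Rightarrow> bms_basis \<Rightarrow> bms" where
  "basis_bracket (L m) (L n) = of_int (n - m) *\<^sub>C gen (L (m + n))"
| "basis_bracket (L m) (W n) = of_int (n - m) *\<^sub>C gen (W (m + n))"
| "basis_bracket (W m) (L n) = of_int (n - m) *\<^sub>C gen (W (m + n))"
| "basis_bracket (L m) (I n) = of_int n *\<^sub>C gen (I (m + n))"
| "basis_bracket (I m) (L n) = of_int (- m) *\<^sub>C gen (I (m + n))"
| "basis_bracket (L m) (J n) = of_int n *\<^sub>C gen (J (m + n))"
| "basis_bracket (J m) (L n) = of_int (- m) *\<^sub>C gen (J (m + n))"
| "basis_bracket (W m) (I n) = of_int (- n) *\<^sub>C gen (J (m + n))"
| "basis_bracket (I m) (W n) = of_int m *\<^sub>C gen (J (m + n))"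
| "basis_bracket _ _ = 0"

definition bracket :: "bms \<Rightarrow> bms \<Rightarrow> bms"
  where "bracket x y = lin_ext (\<lambda>a. lin_ext (basis_bracket a) y) x"

definition bms_component :: "int \<Rightarrow> bms set"
  where "bms_component n = complex_vector.span {gen (L n), gen (W n), gen (I n), gen (J n)}"


section \<open>Modules\<close>

text \<open>A module structure on the space \<open>'v\<close> is an action \<open>bms \<Rightarrow> 'v \<Rightarrow> 'v\<close>. The predicates
  \<open>submodule\<close>, \<open>weight_module\<close>, \<open>isomorphic_modules\<close> and \<open>trivial_one_dim_module\<close> do not include
  the module axioms themselves, so their negations do not hold merely because an axiom fails.\<close>

definition bms_module :: "(bms \<Rightarrow> 'v \<Rightarrow> 'v::complex_vector) \<Rightarrow> bool"
  where "bms_module \<rho> \<longleftrightarrow>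
    (\<forall>v. clinear (\<lambda>x. \<rho> x v)) \<and> (\<forall>x. clinear (\<rho> x)) \<and>
    (\<forall>x y v. \<rho> (bracket x y) v = \<rho> x (\<rho> y v) - \<rho> y (\<rho> x v))"

definition submodule :: "(bms \<Rightarrow> 'v \<Rightarrow> 'v::complex_vector) \<Rightarrow> 'v set \<Rightarrow> bool"
  where "submodule \<rho> S \<longleftrightarrow> complex_vector.subspace S \<and> (\<forall>x. \<forall>v\<in>S. \<rho> x v \<in> S)"

definition irreducible_module :: "(bms \<Rightarrow> 'v \<Rightarrow> 'v::complex_vector) \<Rightarrow> bool"
  where "irreducible_module \<rho> \<longleftrightarrow>
    bms_module \<rho> \<and> (UNIV :: 'v set) \<noteq> {0} \<and> (\<forall>S. submodule \<rho> S \<longrightarrow> S = {0} \<or> S = UNIV)"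

definition restricted_module :: "(bms \<Rightarrow> 'v \<Rightarrow> 'v::complex_vector) \<Rightarrow> bool"
  where "restricted_module \<rho> \<longleftrightarrow>
    bms_module \<rho> \<and> (\<forall>v. \<exists>k::nat. \<forall>n\<ge>int k. \<forall>x\<in>bms_component n. \<rho> x v = 0)"

definition weight_space :: "(bms \<Rightarrow> 'v \<Rightarrow> 'v::complex_vector) \<Rightarrow> complex \<times> complex \<Rightarrow> 'v set"
  where "weight_space \<rho> w =
    {v. \<rho> (gen (L 0)) v = fst w *\<^sub>C v \<and> \<rho> (gen (W 0)) v = snd w *\<^sub>C v}"

definition weight_module :: "(bms \<Rightarrow> 'v \<Rightarrow> 'v::complex_vector) \<Rightarrow> bool"
  where "weight_module \<rho> \<longleftrightarrow>
    (\<forall>v. \<exists>!f. finite {w. f w \<noteq> 0} \<and> (\<forall>w. f w \<in> weight_space \<rho> w) \<and>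
        v = (\<Sum>w | f w \<noteq> 0. f w))"

definition isomorphic_modules ::
    "(bms \<Rightarrow> 'v \<Rightarrow> 'v::complex_vector) \<Rightarrow> (bms \<Rightarrow> 'w \<Rightarrow> 'w::complex_vector) \<Rightarrow> bool"
  where "isomorphic_modules \<rho> \<sigma> \<longleftrightarrow>
    (\<exists>\<phi>. clinear \<phi> \<and> bij \<phi> \<and> (\<forall>x v. \<phi> (\<rho> x v) = \<sigma> x (\<phi> v)))"

definition trivial_one_dim_module :: "(bms \<Rightarrow> 'v \<Rightarrow> 'v::complex_vector) \<Rightarrow> bool"
  where "trivial_one_dim_module \<rho> \<longleftrightarrow>
    complex_vector.dim (UNIV :: 'v set) = 1 \<and> (\<forall>x v. \<rho> x v = 0)"


section \<open>The modules \<open>\<Phi>(\<lambda>, \<alpha>, \<beta>, \<gamma>, h)\<close>\<close>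

text \<open>The space \<open>\<complex>[s, t]\<close> is \<open>complex poly poly\<close>, read as \<open>\<complex>[t][s]\<close>: the outer variable is \<open>s\<close>,
  the coefficients are polynomials in \<open>t\<close>. So \<open>[:p:]\<close> is \<open>p(t)\<close>, \<open>[:p, 1:]\<close> is \<open>s + p(t)\<close>,
  and \<open>[:[:c, 1:]:]\<close> is \<open>t + c\<close>.\<close>

definition shift_s :: "int \<Rightarrow> complex poly poly \<Rightarrow> complex poly poly"
  where "shift_s n f = pcompose f [:- of_int n, 1:]"

definition deriv_t :: "complex poly poly \<Rightarrow> complex poly poly"
  where "deriv_t f = map_poly pderiv f"

definition H_poly :: "complex \<Rightarrow> complex poly \<Rightarrow> complex poly"
  where "H_poly \<alpha> h = (h - [:poly h \<alpha>:]) div [:- \<alpha>, 1:]"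

definition h_sub :: "complex \<Rightarrow> complex poly \<Rightarrow> int \<Rightarrow> complex poly"
  where "h_sub \<alpha> h n = smult (of_int n) h - smult (of_int (n * (n - 1)) * \<alpha>) (H_poly \<alpha> h)"

fun phi_basis ::
    "complex \<Rightarrow> complex \<Rightarrow> complex \<Rightarrow> complex \<Rightarrow> complex poly \<Rightarrow>
     bms_basis \<Rightarrow> complex poly poly \<Rightarrow> complex poly poly" where
  "phi_basis lam \<alpha> \<beta> \<gamma> h (L n) f =
     (lam powi n) *\<^sub>C ([:h_sub \<alpha> h n, 1:] * shift_s n f)
     - (of_int n * lam powi n) *\<^sub>C ([:[:- of_int n * \<alpha>, 1:]:] * deriv_t (shift_s n f))"
| "phi_basis lam \<alpha> \<beta> \<gamma> h (W n) f =
     (lam powi n) *\<^sub>C ([:[:- of_int n * \<alpha>, 1:]:] * shift_s n f)"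
| "phi_basis lam \<alpha> \<beta> \<gamma> h (I n) f =
     (lam powi n) *\<^sub>C ([:[:\<gamma>:] - smult (of_int n * \<beta>) (H_poly \<alpha> h):] * shift_s n f)
     + (of_int n * lam powi n * \<beta>) *\<^sub>C deriv_t (shift_s n f)"
| "phi_basis lam \<alpha> \<beta> \<gamma> h (J n) f = (lam powi n * \<beta>) *\<^sub>C shift_s n f"

definition phi ::
    "complex \<Rightarrow> complex \<Rightarrow> complex \<Rightarrow> complex \<Rightarrow> complex poly \<Rightarrow>
     bms \<Rightarrow> complex poly poly \<Rightarrow> complex poly poly"
  where "phi lam \<alpha> \<beta> \<gamma> h x f = lin_ext (\<lambda>b. phi_basis lam \<alpha> \<beta> \<gamma> h b f) x"

lemma scaleC_poly_poly: "c *\<^sub>C (f :: complex poly poly) = smult [:c:] f"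
  by (simp add: scaleC_poly_def scaleC_complex_def[abs_def] poly_eq_iff coeff_map_poly)

lemma clinear_phi_basis: "clinear (phi_basis lam \<alpha> \<beta> \<gamma> h b)"
proof -
  have s: "shift_s n (f + g) = shift_s n f + shift_s n g"
    "shift_s n (smult c f) = smult c (shift_s n f)" for n f g c
    by (simp_all add: shift_s_def pcompose_add pcompose_smult)
  have d: "deriv_t (f + g) = deriv_t f + deriv_t g"
    "deriv_t (smult [:a:] f) = smult [:a:] (deriv_t f)" for f g a
    by (simp_all add: deriv_t_def poly_eq_iff[of "map_poly _ _"] coeff_map_poly pderiv_add
        pderiv_smult)
  have "phi_basis lam \<alpha> \<beta> \<gamma> h b (f + g) = phi_basis lam \<alpha> \<beta> \<gamma> h b f + phi_basis lam \<alpha> \<beta> \<gamma> h b g" for f g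
    by (cases b)
      (simp_all only: phi_basis.simps s d scaleC_poly_poly distrib_left smult_add_right
        add_diff_add add.assoc add.left_commute)
  moreover have "phi_basis lam \<alpha> \<beta> \<gamma> h b (smult [:c:] f) = smult [:c:] (phi_basis lam \<alpha> \<beta> \<gamma> h b f)" for c f
    by (cases b)
      (simp_all only: phi_basis.simps s d scaleC_poly_poly mult_smult_right smult_smult
        smult_add_right smult_diff_right mult.commute[of "[:c:]"])
  ultimately show ?thesis
    by (simp add: clinear_iff scaleC_poly_poly)
qed

lemma clinear_phi: "clinear (phi lam \<alpha> \<beta> \<gamma> h x)"
  using clinear_phi_basis[of lam \<alpha> \<beta> \<gamma> h]
  by (simp add: phi_def lin_ext_def clinear_iff scaleC_add_right sum.distrib
      complex_vector.scale_sum_right scaleC_scaleC mult.commute)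


section \<open>Tensor products\<close>

text \<open>The type \<open>('k, 'a, 'v) tensor\<close> is \<open>(\<Otimes>\<^bsub>i \<in> 'k\<^esub> 'a) \<otimes> 'v\<close>: the vector space with basis
  \<open>('k \<Rightarrow> 'a) \<times> 'v\<close> modulo the relations of multilinearity in all factors.\<close>

definition tensor_relators ::
    "(('k \<Rightarrow> 'a::complex_vector) \<times> 'v::complex_vector \<Rightarrow>\<^sub>0 complex) set"
  where "tensor_relators =
    {Poly_Mapping.single (a(i := x + y), v) 1
       - Poly_Mapping.single (a(i := x), v) 1 - Poly_Mapping.single (a(i := y), v) 1 |a i x y v. True}
    \<union> {Poly_Mapping.single (a(i := c *\<^sub>C x), v) 1
         - c *\<^sub>C Poly_Mapping.single (a(i := x), v) 1 |a i c x v. True}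
    \<union> {Poly_Mapping.single (a, v + w) 1
         - Poly_Mapping.single (a, v) 1 - Poly_Mapping.single (a, w) 1 |a v w. True}
    \<union> {Poly_Mapping.single (a, c *\<^sub>C v) 1
         - c *\<^sub>C Poly_Mapping.single (a, v) 1 |a c v. True}"

definition tensor_rel ::
    "(('k \<Rightarrow> 'a::complex_vector) \<times> 'v::complex_vector \<Rightarrow>\<^sub>0 complex) \<Rightarrow>
     (('k \<Rightarrow> 'a) \<times> 'v \<Rightarrow>\<^sub>0 complex) \<Rightarrow> bool"
  where "tensor_rel p q \<longleftrightarrow> p - q \<in> complex_vector.span tensor_relators"

lemma equivp_tensor_rel:
  "equivp (tensor_rel ::
    (('k \<Rightarrow> 'a::complex_vector) \<times> 'v::complex_vector \<Rightarrow>\<^sub>0 complex) \<Rightarrow> _ \<Rightarrow> bool)"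
proof (rule equivpI)
  show "reflp (tensor_rel :: (('k \<Rightarrow> 'a) \<times> 'v \<Rightarrow>\<^sub>0 complex) \<Rightarrow> _ \<Rightarrow> bool)"
    by (auto simp: reflp_def tensor_rel_def complex_vector.span_zero)
  show "symp (tensor_rel :: (('k \<Rightarrow> 'a) \<times> 'v \<Rightarrow>\<^sub>0 complex) \<Rightarrow> _ \<Rightarrow> bool)"
  proof (rule sympI)
    fix p q :: "('k \<Rightarrow> 'a) \<times> 'v \<Rightarrow>\<^sub>0 complex"
    assume "tensor_rel p q"
    then show "tensor_rel q p"
      unfolding tensor_rel_def using complex_vector.span_neg[of "p - q" tensor_relators] by simp
  qed
  show "transp (tensor_rel :: (('k \<Rightarrow> 'a) \<times> 'v \<Rightarrow>\<^sub>0 complex) \<Rightarrow> _ \<Rightarrow> bool)"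
  proof (rule transpI)
    fix p q r :: "('k \<Rightarrow> 'a) \<times> 'v \<Rightarrow>\<^sub>0 complex"
    assume "tensor_rel p q" "tensor_rel q r"
    then show "tensor_rel p r"
      unfolding tensor_rel_def
      using complex_vector.span_add[of "p - q" tensor_relators "q - r"] by simp
  qed
qed

quotient_type (overloaded) ('k, 'a, 'v) tensor =
  "('k \<Rightarrow> 'a::complex_vector) \<times> 'v::complex_vector \<Rightarrow>\<^sub>0 complex" / tensor_rel
  by (rule equivp_tensor_rel)

instantiation tensor :: (type, complex_vector, complex_vector) complex_vector
begin

lift_definition zero_tensor :: "('a, 'b, 'c) tensor" is 0 .

lift_definition plus_tensor :: "('a, 'b, 'c) tensor \<Rightarrow> ('a, 'b, 'c) tensor \<Rightarrow> ('a, 'b, 'c) tensor"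
  is "(+)"
  subgoal for p p' q q'
    unfolding tensor_rel_def
    using complex_vector.span_add[of "p - p'" tensor_relators "q - q'"]
    by (simp add: algebra_simps)
  done

lift_definition uminus_tensor :: "('a, 'b, 'c) tensor \<Rightarrow> ('a, 'b, 'c) tensor" is uminus
  subgoal for p p'
    unfolding tensor_rel_def
    using complex_vector.span_neg[of "p - p'" tensor_relators] by simp
  done

lift_definition minus_tensor :: "('a, 'b, 'c) tensor \<Rightarrow> ('a, 'b, 'c) tensor \<Rightarrow> ('a, 'b, 'c) tensor"
  is "(-)"
  subgoal for p p' q q'
    unfolding tensor_rel_def
    using complex_vector.span_diff[of "p - p'" tensor_relators "q - q'"]
    by (simp add: algebra_simps)
  done

lift_definition scaleC_tensor :: "complex \<Rightarrow> ('a, 'b, 'c) tensor \<Rightarrow> ('a, 'b, 'c) tensor" is scaleC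
  subgoal for c p p'
    unfolding tensor_rel_def
    using complex_vector.span_scale[of "p - p'" tensor_relators c]
    by (simp add: complex_vector.scale_right_diff_distrib)
  done

instance
proof -
  have eq: "tensor_rel p p" for p :: "('a \<Rightarrow> 'b) \<times> 'c \<Rightarrow>\<^sub>0 complex"
    by (simp add: tensor_rel_def complex_vector.span_zero)
  show "OFCLASS(('a, 'b, 'c) tensor, complex_vector_class)"
    by standard
      (transfer, simp add: eq algebra_simps scaleC_add_right scaleC_add_left scaleC_scaleC
        scaleC_one)+
qed

end

lift_definition pure_tensor ::
  "('k \<Rightarrow> 'a::complex_vector) \<Rightarrow> 'v::complex_vector \<Rightarrow> ('k, 'a, 'v) tensor"
  is "\<lambda>a v. Poly_Mapping.single (a, v) 1" .

definition multilinear ::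
    "(('k \<Rightarrow> 'a::complex_vector) \<Rightarrow> 'v::complex_vector \<Rightarrow> 'w::complex_vector) \<Rightarrow> bool"
  where "multilinear g \<longleftrightarrow>
    (\<forall>a i v. clinear (\<lambda>x. g (a(i := x)) v)) \<and> (\<forall>a. clinear (g a))"

lemma abs_tensor_eq_iff: "abs_tensor p = abs_tensor q \<longleftrightarrow> tensor_rel p q"
  by (simp add: tensor.abs_eq_iff)

lemma multilinear_pure_tensor:
  "multilinear (pure_tensor ::
    ('k \<Rightarrow> 'a::complex_vector) \<Rightarrow> 'v::complex_vector \<Rightarrow> ('k, 'a, 'v) tensor)"
proof -
  have r: "abs_tensor p = abs_tensor q" if "p - q \<in> tensor_relators"
    for p q :: "('k \<Rightarrow> 'a) \<times> 'v \<Rightarrow>\<^sub>0 complex"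
    using that by (simp add: abs_tensor_eq_iff tensor_rel_def complex_vector.span_base)
  show ?thesis
    unfolding multilinear_def clinear_iff pure_tensor.abs_eq plus_tensor.abs_eq
      scaleC_tensor.abs_eq
  proof (intro conjI allI; rule r; unfold diff_diff_add[symmetric] tensor_relators_def Un_iff)
  qed (rule disjI1, rule disjI1, rule disjI1, blast,
      rule disjI1, rule disjI1, rule disjI2, blast,
      rule disjI1, rule disjI2, blast,
      rule disjI2, blast)
qed

lemma clinear_tensor_eqI:
  fixes A B :: "('k, 'a::complex_vector, 'v::complex_vector) tensor \<Rightarrow> 'w::complex_vector"
  assumes "clinear A" "clinear B" "\<And>a v. A (pure_tensor a v) = B (pure_tensor a v)"
  shows "A = B"
proof
  fix w :: "('k, 'a, 'v) tensor"
  have lin: "clinear (\<lambda>p. C (abs_tensor p))" if "clinear C" for C :: "('k, 'a, 'v) tensor \<Rightarrow> 'w"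
    using that by (simp add: clinear_iff flip: plus_tensor.abs_eq scaleC_tensor.abs_eq)
  obtain p where w: "w = abs_tensor p"
    by (induction w) blast
  have "A (abs_tensor p) = lin_ext (\<lambda>b. A (abs_tensor (Poly_Mapping.single b 1))) p"
    by (rule lin_ext_unique[OF lin[OF assms(1)]]) simp
  also have "\<dots> = lin_ext (\<lambda>b. B (abs_tensor (Poly_Mapping.single b 1))) p"
    using assms(3) by (intro arg_cong[where f = "\<lambda>g. lin_ext g p"] ext)
      (auto simp: pure_tensor.abs_eq)
  also have "\<dots> = B (abs_tensor p)"
    by (rule lin_ext_unique[OF lin[OF assms(2)], symmetric]) simp
  finally show "A w = B w"
    by (simp add: w)
qed

lemma tensor_universal:
  fixes g :: "('k \<Rightarrow> 'a::complex_vector) \<Rightarrow> 'v::complex_vector \<Rightarrow> 'w::complex_vector"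
  assumes "multilinear g"
  shows "\<exists>!A. clinear A \<and> (\<forall>a v. A (pure_tensor a v) = g a v)"
proof -
  define G where "G = lin_ext (\<lambda>(a, v). g a v)"
  have G: "clinear G"
    by (simp add: G_def clinear_lin_ext)
  have Gd: "G (p - q) = G p - G q" for p q
  proof -
    have "G (p - q + q) = G (p - q) + G q"
      using G unfolding clinear_iff by blast
    then show ?thesis
      by simp
  qed
  have Gs: "G (Poly_Mapping.single (a, v) c) = c *\<^sub>C g a v" for a v c
    by (simp add: G_def lin_ext_single)
  have "G p = 0" if "p \<in> tensor_relators" for p
    using that assms G
    by (auto simp: tensor_relators_def Gd Gs scaleC_one multilinear_def clinear_iff)
  moreover have "complex_vector.subspace {p. G p = 0}"
    using G Gs[of undefined undefined 0]
    by (auto simp: complex_vector.subspace_def clinear_iff)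
  ultimately have G0: "G p = 0" if "p \<in> complex_vector.span tensor_relators" for p
    using complex_vector.span_minimal[of tensor_relators "{p. G p = 0}"] that by blast
  define A where "A w = G (rep_tensor w)" for w
  have A: "A (abs_tensor p) = G p" for p
  proof -
    have "tensor_rel (rep_tensor (abs_tensor p)) p"
      using Quotient3_rep_abs[OF Quotient3_tensor] equivp_reflp[OF equivp_tensor_rel] by blast
    then show ?thesis
      using G0[of "rep_tensor (abs_tensor p) - p"] by (simp add: A_def tensor_rel_def Gd)
  qed
  have "A (v + w) = A v + A w" "A (c *\<^sub>C v) = c *\<^sub>C A v" for v w c
    using G by (induction v; induction w; simp add: A plus_tensor.abs_eq scaleC_tensor.abs_eq clinear_iff)+
  then have "clinear A"
    by (simp add: clinear_iff)
  moreover have "A (pure_tensor a v) = g a v" for a v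
    by (simp add: pure_tensor.abs_eq A Gs scaleC_one)
  ultimately show ?thesis
    by (intro ex1I[of _ A] conjI allI clinear_tensor_eqI) simp_all
qed

text \<open>For linear \<open>\<rho> i x\<close> and \<open>\<sigma> x\<close> the linear map below exists and is unique, see
  \<open>tensor_action_pure\<close>.\<close>

definition tensor_action ::
    "('k::finite \<Rightarrow> bms \<Rightarrow> 'a \<Rightarrow> 'a::complex_vector) \<Rightarrow> (bms \<Rightarrow> 'v \<Rightarrow> 'v::complex_vector) \<Rightarrow>
     bms \<Rightarrow> ('k, 'a, 'v) tensor \<Rightarrow> ('k, 'a, 'v) tensor"
  where "tensor_action \<rho> \<sigma> x =
    (THE A. clinear A \<and>
      (\<forall>a v. A (pure_tensor a v) =
        (\<Sum>i\<in>UNIV. pure_tensor (a(i := \<rho> i x (a i))) v) + pure_tensor a (\<sigma> x v)))"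

lemma
  fixes \<rho> :: "'k::finite \<Rightarrow> bms \<Rightarrow> 'a \<Rightarrow> 'a::complex_vector"
    and \<sigma> :: "bms \<Rightarrow> 'v \<Rightarrow> 'v::complex_vector"
  assumes \<rho>: "\<And>i. clinear (\<rho> i x)" and \<sigma>: "clinear (\<sigma> x)"
  shows clinear_tensor_action: "clinear (tensor_action \<rho> \<sigma> x)"
    and tensor_action_pure: "tensor_action \<rho> \<sigma> x (pure_tensor a v) =
      (\<Sum>i\<in>UNIV. pure_tensor (a(i := \<rho> i x (a i))) v) + pure_tensor a (\<sigma> x v)"
proof -
  let ?g = "\<lambda>a v. (\<Sum>i\<in>UNIV. pure_tensor (a(i := \<rho> i x (a i))) v) + pure_tensor a (\<sigma> x v)"
  have p: "clinear (\<lambda>y. pure_tensor (a(i := y)) v)" "clinear (pure_tensor a :: 'v \<Rightarrow> _)"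
    for a :: "'k \<Rightarrow> 'a" and i and v :: 'v
    using multilinear_pure_tensor[where 'k = 'k and 'a = 'a and 'v = 'v]
    unfolding multilinear_def by blast+
  have add: "clinear (\<lambda>y. f y + h y)" if "clinear f" "clinear h"
    for f h :: "'c::complex_vector \<Rightarrow> ('k, 'a, 'v) tensor"
    using that by (simp add: clinear_iff scaleC_add_right)
  have sum: "clinear (\<lambda>y. \<Sum>i\<in>UNIV. f i y)" if "\<And>i. clinear (f i)"
    for f :: "'k \<Rightarrow> 'c::complex_vector \<Rightarrow> ('k, 'a, 'v) tensor"
    using that by (simp add: clinear_iff sum.distrib complex_vector.scale_sum_right)
  have 1: "clinear (\<lambda>y. pure_tensor ((a(j := y))(i := \<rho> i x ((a(j := y)) i))) v)"
    for a :: "'k \<Rightarrow> 'a" and i j and v :: 'v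
  proof (cases "i = j")
    case True
    then show ?thesis
      using p(1) \<rho>[of j] by (simp add: clinear_iff)
  next
    case False
    then show ?thesis
      using p(1)[of "a(i := \<rho> i x (a i))" j v] by (simp add: fun_upd_twist)
  qed
  have 2: "clinear (\<lambda>v. pure_tensor a (\<sigma> x v))" for a :: "'k \<Rightarrow> 'a"
    using p(2)[of a] \<sigma> by (simp add: clinear_iff)
  have "multilinear ?g"
    unfolding multilinear_def by (intro conjI allI add sum 1 2 p)
  from theI'[OF tensor_universal[OF this]]
  show "clinear (tensor_action \<rho> \<sigma> x)" "tensor_action \<rho> \<sigma> x (pure_tensor a v) = ?g a v"
    unfolding tensor_action_def by blast+
qed

end

theory Submission
  imports Defs
begin

text \<open>On \<open>\<Phi>(\<lambda>, \<alpha>, \<beta>, \<gamma>, h)\<close> the elements \<open>L\<^sub>0\<close> and \<open>W\<^sub>0\<close> act as multiplication by \<open>s\<close> and \<open>t\<close>. Hence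
  \<open>L\<^sub>0\<close> strictly raises the degree of \<open>T\<close> in each \<open>s\<^sub>j\<close> and has no eigenvectors, so \<open>T\<close> is not a weight
  module. For large \<open>n\<close> the element \<open>W\<^sub>n\<close> kills \<open>v\<close>, but the coefficient of \<open>t\<^sub>j\<close> in \<open>W\<^sub>n (1 \<otimes> v)\<close> is
  \<open>\<lambda>\<^sub>j\<^sup>n v \<noteq> 0\<close>, so \<open>T\<close> is not restricted. Finally, \<open>\<Phi>\<close> is free of rank one over \<open>\<complex>[L\<^sub>0, W\<^sub>0]\<close>, so its
  quotient by the images of \<open>L\<^sub>0\<close> and \<open>W\<^sub>0\<close> is a line; the same quotient of \<open>T\<close> is the tensor product
  of all factors but one \<open>\<Phi>\<close>, which is a line only if there is one \<open>\<Phi>\<close> and \<open>dim V = 1\<close>. Then \<open>V\<close> is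
  trivial because the algebra is perfect.\<close>

section \<open>Linear maps and pure tensors\<close>

lemma
  assumes "clinear f"
  shows clinear_add: "f (x + y) = f x + f y"
    and clinear_scaleC: "f (c *\<^sub>C x) = c *\<^sub>C f x"
    and clinear_zero: "f 0 = 0"
    and clinear_uminus: "f (- x) = - f x"
    and clinear_sum: "f (sum g A) = (\<Sum>i\<in>A. f (g i))"
proof -
  interpret module_hom "(*\<^sub>C)" "(*\<^sub>C)" f
    using assms by (simp add: linear_iff_module_hom)
  show "f (x + y) = f x + f y" "f (c *\<^sub>C x) = c *\<^sub>C f x" "f 0 = 0" "f (- x) = - f x"
    "f (sum g A) = (\<Sum>i\<in>A. f (g i))"
    by (rule add scale zero neg sum)+
qed

lemma clinear_compose:
  assumes "clinear f" "clinear g"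
  shows "clinear (\<lambda>x. f (g x))"
  using assms by (simp add: clinear_iff)

lemma clinear_pure_slot: "clinear (\<lambda>x. pure_tensor (a(i := x)) v)"
  by (rule multilinear_pure_tensor[unfolded multilinear_def, THEN conjunct1, rule_format])

lemma clinear_pure_right: "clinear (pure_tensor a)"
  by (rule multilinear_pure_tensor[unfolded multilinear_def, THEN conjunct2, rule_format])

text \<open>A representative in the free vector space is a finite combination of basis vectors, so
  the pure tensors span.\<close>

lemma tensor_induct_subspace:
  fixes w :: "('k, 'a::complex_vector, 'v::complex_vector) tensor"
  assumes "complex_vector.subspace U" "\<And>a v. pure_tensor a v \<in> U"
  shows "w \<in> U"
proof -
  obtain p where w: "w = abs_tensor p"
    by (induction w) blast
  have "clinear (abs_tensor :: _ \<Rightarrow> ('k, 'a, 'v) tensor)"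
    by (simp add: clinear_iff plus_tensor.abs_eq scaleC_tensor.abs_eq)
  then have "abs_tensor p = lin_ext (\<lambda>b. pure_tensor (fst b) (snd b)) p"
    by (rule lin_ext_unique) (simp add: pure_tensor.abs_eq)
  then show ?thesis
    unfolding w lin_ext_def
    by (simp add: complex_vector.subspace_sum[OF assms(1)] complex_vector.subspace_scale[OF assms(1)] assms(2))
qed

section \<open>Coefficients of tensors in one pair of variables\<close>

definition bicoeff :: "nat \<Rightarrow> nat \<Rightarrow> complex poly poly \<Rightarrow> complex"
  where "bicoeff m n f = coeff (coeff f m) n"

lemma clinear_bicoeff: "clinear (bicoeff m n)"
  unfolding clinear_iff by (simp add: bicoeff_def scaleC_poly_poly scaleC_complex_def)

lemma bicoeff_scaleC [simp]: "bicoeff m n (c *\<^sub>C f) = c * bicoeff m n f"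
  by (simp add: bicoeff_def scaleC_poly_poly)

lemma bicoeff_one [simp]: "bicoeff m n 1 = (if m = 0 \<and> n = 0 then 1 else 0)"
  by (auto simp: bicoeff_def)

text \<open>The coefficient of \<open>s\<^sub>j\<^sup>m t\<^sub>j\<^sup>n\<close> in \<open>\<Prod>\<^sub>k a\<^sub>k(s\<^sub>k, t\<^sub>k)\<close>.\<close>

definition jet :: "'k::finite \<Rightarrow> nat \<Rightarrow> nat \<Rightarrow> ('k \<Rightarrow> complex poly poly) \<Rightarrow> complex"
  where "jet j m n a = bicoeff m n (a j) * (\<Prod>k\<in>UNIV - {j}. bicoeff 0 0 (a k))"

text \<open>The contribution of slot \<open>k\<close> is isolated, so that linearity in that slot
  can be read off. A slot other than \<open>j\<close> enters only through its constant term.\<close>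

lemma jet_upd:
  "jet j m n (a(k := f)) =
    (if k = j then bicoeff m n f * (\<Prod>k\<in>UNIV - {j}. bicoeff 0 0 (a k))
     else bicoeff 0 0 f * (bicoeff m n (a j) * (\<Prod>l\<in>UNIV - {j} - {k}. bicoeff 0 0 (a l))))"
proof (cases "k = j")
  case True
  then show ?thesis by (auto simp: jet_def intro!: prod.cong)
next
  case False
  then show ?thesis
    by (auto simp: jet_def prod.remove[of "UNIV - {j}" k] intro!: prod.cong)
qed

lemma jet_one [simp]: "jet j m n (\<lambda>_. 1) = (if m = 0 \<and> n = 0 then 1 else 0)"
  by (simp add: jet_def)

lemma clinear_jet: "clinear (\<lambda>f. jet j m n (a(k := f)))"
  unfolding clinear_iff
  by (cases "k = j") (simp_all add: jet_upd scaleC_complex_def clinear_add[OF clinear_bicoeff] algebra_simps)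

text \<open>Contracting all polynomial factors with \<open>jet\<close> leaves a vector of
  \<open>'v\<close>, where nonvanishing of a tensor can be tested. The universal property makes the
  description definite.\<close>

definition slice ::
    "'k::finite \<Rightarrow> nat \<Rightarrow> nat \<Rightarrow> ('k, complex poly poly, 'v::complex_vector) tensor \<Rightarrow> 'v"
  where "slice j m n = (THE A. clinear A \<and> (\<forall>a v. A (pure_tensor a v) = jet j m n a *\<^sub>C v))"

lemma clinear_slice: "clinear (slice j m n)"
  and slice_pure [simp]: "slice j m n (pure_tensor a v) = jet j m n a *\<^sub>C v"
proof -
  have "multilinear (\<lambda>a v. jet j m n a *\<^sub>C v)"
    using clinear_jet[of j m n] unfolding multilinear_def clinear_iff
    by (simp add: scaleC_complex_def scaleC_add_left scaleC_add_right
        scaleC_scaleC mult.commute)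
  from theI'[OF tensor_universal[OF this]]
  show "clinear (slice j m n)" "slice j m n (pure_tensor a v) = jet j m n a *\<^sub>C v"
    unfolding slice_def by blast+
qed

section \<open>Action on a single factor, and absence of \<open>L 0\<close>-eigenvectors\<close>

lemma phi_gen: "phi lam \<alpha> \<beta> \<gamma> h (gen b) f = phi_basis lam \<alpha> \<beta> \<gamma> h b f"
  by (simp add: phi_def lin_ext_single scaleC_one)

text \<open>In degree 0 the shift is the identity, and \<open>h_sub\<close> and the derivative term
  vanish. As s is the outer variable, \<open>pCons 0\<close> is multiplication by s.\<close>

lemma phi_L0: "phi lam \<alpha> \<beta> \<gamma> h (gen (L 0)) f = pCons 0 f"
  by (simp add: phi_gen shift_s_def h_sub_def scaleC_one pcompose_idR)

lemma phi_W0: "phi lam \<alpha> \<beta> \<gamma> h (gen (W 0)) f = smult [:0, 1:] f"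
  by (simp add: phi_gen shift_s_def scaleC_one pcompose_idR)

text \<open>What matters later is the coefficient of t: it is \<open>lam powi n\<close>, which does
  not vanish in any degree when \<open>lam\<close> is nonzero.\<close>

lemma phi_W_one:
  "phi lam \<alpha> \<beta> \<gamma> h (gen (W n)) 1 = (lam powi n) *\<^sub>C [:[:- of_int n * \<alpha>, 1:]:]"
  by (simp add: phi_gen shift_s_def pcompose_1)

text \<open>Multiplying factor \<open>j\<close> by \<open>s\<^sub>j\<close> shifts the slices; multiplying another factor by its \<open>s\<^sub>k\<close> kills them.\<close>

lemma slice_tensor_L0:
  fixes \<rho> :: "'k::finite \<Rightarrow> bms \<Rightarrow> complex poly poly \<Rightarrow> complex poly poly"
    and \<sigma> :: "bms \<Rightarrow> 'v \<Rightarrow> 'v::complex_vector"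
  assumes \<rho>: "\<And>k x. clinear (\<rho> k x)" "\<And>k f. \<rho> k (gen (L 0)) f = pCons 0 f"
    and \<sigma>: "\<And>x. clinear (\<sigma> x)"
  shows "slice j (Suc n) 0 (tensor_action \<rho> \<sigma> (gen (L 0)) w) =
    slice j n 0 w + \<sigma> (gen (L 0)) (slice j (Suc n) 0 w)"
proof -
  let ?L = "gen (L 0)"
  have "(\<lambda>w. slice j (Suc n) 0 (tensor_action \<rho> \<sigma> ?L w)) =
    (\<lambda>w. slice j n 0 w + \<sigma> ?L (slice j (Suc n) 0 w))"
  proof (rule clinear_tensor_eqI)
    show "clinear (\<lambda>w. slice j (Suc n) 0 (tensor_action \<rho> \<sigma> ?L w))"
      by (rule clinear_compose[OF clinear_slice clinear_tensor_action]) fact+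
    show "clinear (\<lambda>w. slice j n 0 w + \<sigma> ?L (slice j (Suc n) 0 w))"
      by (simp add: clinear_iff clinear_add[OF clinear_slice] clinear_scaleC[OF clinear_slice]
          clinear_add[OF \<sigma>] clinear_scaleC[OF \<sigma>] scaleC_add_right)
    fix a :: "'k \<Rightarrow> complex poly poly" and v :: 'v
    have *: "jet j (Suc n) 0 (a(k := \<rho> k ?L (a k))) = (if k = j then jet j n 0 a else 0)" for k
      by (auto simp: jet_upd \<rho>(2) bicoeff_def) (simp add: jet_def bicoeff_def)
    have "slice j (Suc n) 0 (\<Sum>k\<in>UNIV. pure_tensor (a(k := \<rho> k ?L (a k))) v) =
      (\<Sum>k\<in>UNIV. if k = j then jet j n 0 a *\<^sub>C v else 0)"
      unfolding clinear_sum[OF clinear_slice] slice_pure * by (intro sum.cong) auto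
    then show "slice j (Suc n) 0 (tensor_action \<rho> \<sigma> ?L (pure_tensor a v)) =
      slice j n 0 (pure_tensor a v) + \<sigma> ?L (slice j (Suc n) 0 (pure_tensor a v))"
      using tensor_action_pure[of \<rho> ?L \<sigma> a v] \<rho> \<sigma>
      by (simp add: clinear_add[OF clinear_slice] clinear_scaleC[OF \<sigma>])
  qed
  then show ?thesis by meson
qed

text \<open>A pure tensor has finite degree in the variable s of factor \<open>j\<close>, and degree
  bounds survive linear combinations.\<close>

lemma slice_eventually_zero:
  fixes w :: "('a::finite, complex poly poly, 'b::complex_vector) tensor"
  shows "\<exists>N. \<forall>n\<ge>N. slice j n 0 w = 0"
proof -
  have "w \<in> {w. \<exists>N. \<forall>n\<ge>N. slice j n 0 w = 0}"
  proof (rule tensor_induct_subspace)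
    show "complex_vector.subspace {w :: ('a, complex poly poly, 'b) tensor. \<exists>N. \<forall>n\<ge>N. slice j n 0 w = 0}"
      unfolding complex_vector.subspace_def
    proof (intro conjI ballI allI)
      fix x y :: "('a, complex poly poly, 'b) tensor"
      assume "x \<in> {w. \<exists>N. \<forall>n\<ge>N. slice j n 0 w = 0}" "y \<in> {w. \<exists>N. \<forall>n\<ge>N. slice j n 0 w = 0}"
      then obtain N M where "\<forall>n\<ge>N. slice j n 0 x = 0" "\<forall>n\<ge>M. slice j n 0 y = 0" by auto
      then have "\<forall>n\<ge>max N M. slice j n 0 (x + y) = 0"
        by (simp add: clinear_add[OF clinear_slice])
      then show "x + y \<in> {w. \<exists>N. \<forall>n\<ge>N. slice j n 0 w = 0}" by blast
    qed (auto simp: clinear_zero[OF clinear_slice] clinear_scaleC[OF clinear_slice])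
  next
    fix a :: "'a \<Rightarrow> complex poly poly" and v :: 'b
    have "\<forall>n\<ge>Suc (degree (a j)). slice j n 0 (pure_tensor a v) = 0"
      by (simp add: jet_def bicoeff_def coeff_eq_0)
    then show "pure_tensor a v \<in> {w. \<exists>N. \<forall>n\<ge>N. slice j n 0 w = 0}" by blast
  qed
  then show ?thesis by simp
qed

text \<open>Descent on the degree: on an eigenvector, \<open>slice_tensor_L0\<close> expresses slice
  \<open>n\<close> through slice \<open>Suc n\<close>, so vanishing in high degree propagates down
  to 0.\<close>

lemma slice_L0_eigenvector:
  fixes \<rho> :: "'k::finite \<Rightarrow> bms \<Rightarrow> complex poly poly \<Rightarrow> complex poly poly"
    and \<sigma> :: "bms \<Rightarrow> 'v \<Rightarrow> 'v::complex_vector"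
  assumes \<rho>: "\<And>k x. clinear (\<rho> k x)" "\<And>k f. \<rho> k (gen (L 0)) f = pCons 0 f"
    and \<sigma>: "\<And>x. clinear (\<sigma> x)"
    and w: "tensor_action \<rho> \<sigma> (gen (L 0)) w = c *\<^sub>C w"
  shows "slice j 0 0 w = 0"
proof -
  have step: "slice j n 0 w = 0" if "slice j (Suc n) 0 w = 0" for n
    using slice_tensor_L0[of \<rho> \<sigma> j n w] \<rho> \<sigma> w that
    by (simp add: clinear_scaleC[OF clinear_slice] clinear_zero[OF \<sigma>])
  obtain N where N: "slice j N 0 w = 0"
    using slice_eventually_zero by blast
  show ?thesis
    by (rule inc_induct[of 0 N "\<lambda>n. slice j n 0 w = 0"]) (use N step in auto)
qed

text \<open>Weight vectors, hence their sums, have zero constant slice, whereas that of 1 \<otimes>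
  v is \<open>v\<close>.\<close>

lemma not_weight_module:
  fixes \<rho> :: "'k::finite \<Rightarrow> bms \<Rightarrow> complex poly poly \<Rightarrow> complex poly poly"
    and \<sigma> :: "bms \<Rightarrow> 'v \<Rightarrow> 'v::complex_vector"
  assumes \<rho>: "\<And>k x. clinear (\<rho> k x)" "\<And>k f. \<rho> k (gen (L 0)) f = pCons 0 f"
    and \<sigma>: "\<And>x. clinear (\<sigma> x)"
    and "(v :: 'v) \<noteq> 0"
  shows "\<not> weight_module (tensor_action \<rho> \<sigma>)"
proof
  assume "weight_module (tensor_action \<rho> \<sigma>)"
  then obtain f where f: "\<And>w. f w \<in> weight_space (tensor_action \<rho> \<sigma>) w"
    "pure_tensor (\<lambda>_. 1) v = (\<Sum>w | f w \<noteq> 0. f w)"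
    unfolding weight_module_def by blast
  \<comment> \<open>Types are nonempty, so at least one factor \<Phi> exists.\<close>
  obtain j :: 'k where True by simp
  have "slice j 0 0 (f w) = 0" for w
    by (rule slice_L0_eigenvector[of \<rho> \<sigma>, OF \<rho> \<sigma>]) (use f(1)[of w] in \<open>auto simp: weight_space_def\<close>)
  then have "slice j 0 0 (pure_tensor (\<lambda>_. 1) v) = 0"
    by (simp only: f(2) clinear_sum[OF clinear_slice]) simp
  then show False using \<open>v \<noteq> 0\<close> by (simp add: scaleC_one)
qed

section \<open>Failure of restrictedness\<close>

text \<open>Vanishing of \<open>\<tau> x (\<phi> v)\<close> pulls back along the injective map
  \<open>\<phi>\<close>.\<close>

lemma isomorphic_restricted_module:
  assumes "isomorphic_modules \<rho> \<tau>" "restricted_module \<tau>"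
  shows "\<exists>k::nat. \<forall>n\<ge>int k. \<forall>x\<in>bms_component n. \<rho> x v = 0"
proof -
  obtain \<phi> where \<phi>: "clinear \<phi>" "bij \<phi>" "\<And>x v. \<phi> (\<rho> x v) = \<tau> x (\<phi> v)"
    using assms(1) unfolding isomorphic_modules_def by blast
  have "\<rho> x v = 0" if "\<tau> x (\<phi> v) = 0" for x
    using that \<phi>(3)[of x v] clinear_zero[OF \<phi>(1)] bij_is_inj[OF \<phi>(2)] by (metis injD)
  then show ?thesis
    using assms(2) unfolding restricted_module_def by metis
qed

lemma not_isomorphic_restricted:
  fixes lam :: "'k::finite \<Rightarrow> complex" and \<sigma> :: "bms \<Rightarrow> 'v \<Rightarrow> 'v::complex_vector" and v :: 'v
  assumes "\<And>i. lam i \<noteq> 0" "restricted_module \<sigma>" "v \<noteq> 0" "restricted_module \<tau>"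
  shows "\<not> isomorphic_modules
    (tensor_action (\<lambda>i. phi (lam i) (\<alpha> i) (\<beta> i) (\<gamma> i) (h i)) \<sigma>) \<tau>"
    (is "\<not> isomorphic_modules (tensor_action ?\<rho> \<sigma>) \<tau>")
proof
  assume "isomorphic_modules (tensor_action ?\<rho> \<sigma>) \<tau>"
  from isomorphic_restricted_module[OF this assms(4), of "pure_tensor (\<lambda>_. 1) v"]
  obtain k :: nat where k: "\<And>n x. n \<ge> int k \<Longrightarrow> x \<in> bms_component n \<Longrightarrow>
      tensor_action ?\<rho> \<sigma> x (pure_tensor (\<lambda>_. 1) v) = 0"
    by blast
  obtain l :: nat where l: "\<And>n x. n \<ge> int l \<Longrightarrow> x \<in> bms_component n \<Longrightarrow> \<sigma> x v = 0"
    using assms(2) unfolding restricted_module_def by blast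
  have \<sigma>: "\<And>x. clinear (\<sigma> x)"
    using assms(2) by (simp add: restricted_module_def bms_module_def)
  \<comment> \<open>Beyond both bounds, \<open>W n\<close> annihilates 1 \<otimes> v in the tensor
    product and \<open>v\<close> in the last factor.\<close>
  define n where "n = int (max k l)"
  let ?W = "gen (W n)"
  have W: "?W \<in> bms_component n"
    unfolding bms_component_def by (rule complex_vector.span_base) simp
  obtain j :: 'k where True by simp
  let ?a = "\<lambda>_::'k. 1 :: complex poly poly"
  have \<sigma>W: "\<sigma> ?W v = 0"
    using l[OF _ W] by (simp add: n_def)
  have "(\<Sum>i\<in>UNIV. pure_tensor (?a(i := ?\<rho> i ?W 1)) v) = 0"
    using k[OF _ W] tensor_action_pure[of ?\<rho> ?W \<sigma> ?a v, OF clinear_phi \<sigma>]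
    by (simp add: n_def[symmetric] \<sigma>W clinear_zero[OF clinear_pure_right]) (simp add: n_def)
  then have "(\<Sum>i\<in>UNIV. jet j 0 1 (?a(i := ?\<rho> i ?W 1)) *\<^sub>C v) = 0"
    using clinear_sum[OF clinear_slice[of j 0 1], of "\<lambda>i. pure_tensor (?a(i := ?\<rho> i ?W 1)) v" UNIV]
    by (simp add: clinear_zero[OF clinear_slice])
  \<comment> \<open>Acting on a factor other than \<open>j\<close> leaves 1 in slot
    \<open>j\<close>, which has no linear term in t.\<close>
  moreover have "jet j 0 1 (?a(i := ?\<rho> i ?W 1)) = (if i = j then lam j powi n else 0)" for i
    by (simp add: jet_upd phi_W_one) (simp add: bicoeff_def)
  ultimately have "(\<Sum>i\<in>UNIV. if i = j then (lam j powi n) *\<^sub>C v else 0) = 0"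
    by (simp add: if_distrib[of "\<lambda>c. c *\<^sub>C v"] cong: if_cong)
  then show False
    using assms(1,3) by simp
qed


section \<open>Polynomials in two commuting operators\<close>

text \<open>For linear \<open>A\<close> this is the sum of the vectors \<open>A^k (g c_k)\<close>
  over the coefficients \<open>c_k\<close>. Keeping \<open>g\<close> general lets it serve both for
  t, with scalar coefficients, and for s, with coefficients in \<complex>[t].\<close>

definition horner :: "('a::zero \<Rightarrow> 'v::ab_group_add) \<Rightarrow> ('v \<Rightarrow> 'v) \<Rightarrow> 'a poly \<Rightarrow> 'v"
  where "horner g A p = fold_coeffs (\<lambda>c x. g c + A x) p 0"

text \<open>The hypotheses cover the case \<open>pCons 0 0 = 0\<close>, in which the fold takes no
  step.\<close>

lemma horner_pCons:
  assumes "g 0 = 0" "A 0 = 0"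
  shows "horner g A (pCons c p) = g c + A (horner g A p)"
  using assms by (cases "p = 0 \<and> c = 0") (auto simp: horner_def)

lemma horner_0 [simp]: "horner g A 0 = 0"
  by (simp add: horner_def)

definition eval_op :: "('v \<Rightarrow> 'v) \<Rightarrow> complex poly \<Rightarrow> 'v \<Rightarrow> 'v::complex_vector"
  where "eval_op B p x = horner (\<lambda>c. c *\<^sub>C x) B p"

text \<open>The operator f(A, B): s is replaced by \<open>A\<close> and t by
  \<open>B\<close>.\<close>

definition eval_ops :: "('v \<Rightarrow> 'v) \<Rightarrow> ('v \<Rightarrow> 'v) \<Rightarrow> complex poly poly \<Rightarrow> 'v \<Rightarrow> 'v::complex_vector"
  where "eval_ops A B f x = horner (\<lambda>p. eval_op B p x) A f"

locale commuting_ops =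
  fixes A B :: "'v \<Rightarrow> 'v::complex_vector"
  assumes A: "clinear A" and B: "clinear B" and AB: "A (B x) = B (A x)"
begin

lemmas lin = clinear_add[OF A] clinear_scaleC[OF A] clinear_zero[OF A]
  clinear_add[OF B] clinear_scaleC[OF B] clinear_zero[OF B]

lemma eval_op_pCons: "eval_op B (pCons c p) x = c *\<^sub>C x + B (eval_op B p x)"
  by (simp add: eval_op_def horner_pCons lin)

lemma eval_op_0 [simp]: "eval_op B 0 x = 0"
  by (simp add: eval_op_def)

lemma eval_0 [simp]: "eval_ops A B 0 x = 0"
  by (simp add: eval_ops_def)

lemma eval_pCons: "eval_ops A B (pCons p f) x = eval_op B p x + A (eval_ops A B f x)"
  by (simp add: eval_ops_def horner_pCons lin)

lemma eval_one: "eval_ops A B 1 x = x"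
  by (simp add: one_pCons eval_pCons eval_op_pCons lin scaleC_one)

lemma eval_op_add_poly: "eval_op B (p + q) x = eval_op B p x + eval_op B q x"
  by (induction p q rule: poly_induct2) (simp_all add: eval_op_pCons lin scaleC_add_left algebra_simps)

lemma eval_op_smult: "eval_op B (smult c p) x = c *\<^sub>C eval_op B p x"
  by (induction p) (simp_all add: eval_op_pCons lin scaleC_add_right scaleC_scaleC)

lemma eval_op_add: "eval_op B p (x + y) = eval_op B p x + eval_op B p y"
  by (induction p) (simp_all add: eval_op_pCons lin scaleC_add_right algebra_simps)

lemma eval_op_scaleC: "eval_op B p (c *\<^sub>C x) = c *\<^sub>C eval_op B p x"
  by (induction p) (simp_all add: eval_op_pCons lin scaleC_add_right scaleC_scaleC mult.commute)

lemma eval_op_commute: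
  assumes "clinear C" "\<And>x. C (B x) = B (C x)"
  shows "eval_op B p (C x) = C (eval_op B p x)"
  by (induction p)
    (simp_all add: eval_op_pCons assms(2) clinear_add[OF assms(1)] clinear_scaleC[OF assms(1)] clinear_zero[OF assms(1)])

lemma clinear_eval_poly: "clinear (\<lambda>f. eval_ops A B f x)"
proof -
  have "eval_ops A B (f + g) x = eval_ops A B f x + eval_ops A B g x" for f g
    by (induction f g rule: poly_induct2) (simp_all add: eval_pCons eval_op_add_poly lin algebra_simps)
  moreover have "eval_ops A B (smult [:c:] f) x = c *\<^sub>C eval_ops A B f x" for c f
    by (induction f) (simp_all add: eval_pCons eval_op_smult lin scaleC_add_right)
  ultimately show ?thesis
    by (simp add: clinear_iff scaleC_poly_poly)
qed

lemma clinear_eval: "clinear (eval_ops A B f)"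
  unfolding clinear_iff
  by (induction f)
    (simp_all add: eval_pCons eval_op_add eval_op_scaleC lin scaleC_add_right algebra_simps)

lemma eval_commute:
  assumes "clinear C" "\<And>x. C (A x) = A (C x)" "\<And>x. C (B x) = B (C x)"
  shows "eval_ops A B f (C x) = C (eval_ops A B f x)"
  by (induction f)
    (simp_all add: eval_pCons eval_op_commute[OF assms(1,3)] assms(2) clinear_add[OF assms(1)] clinear_zero[OF assms(1)])

lemma eval_s: "eval_ops A B (pCons 0 f) x = A (eval_ops A B f x)"
  by (simp add: eval_pCons)

text \<open>Commutation of the two operators moves \<open>B\<close> out past the powers of
  \<open>A\<close>.\<close>

lemma eval_t: "eval_ops A B (smult [:0, 1:] f) x = B (eval_ops A B f x)"
  by (induction f) (simp_all add: eval_pCons eval_op_pCons lin AB scaleC_one)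

end

section \<open>Commuting actions on tensor products and on a line\<close>

text \<open>Actions in different slots always commute; those in the same slot do so by hypothesis.
  This will make \<open>L 0\<close> and \<open>W 0\<close> available for substitution into
  polynomials.\<close>

lemma tensor_action_commute:
  fixes \<rho> :: "'k::finite \<Rightarrow> bms \<Rightarrow> 'a \<Rightarrow> 'a::complex_vector"
    and \<sigma> :: "bms \<Rightarrow> 'v \<Rightarrow> 'v::complex_vector"
  assumes \<rho>: "\<And>k x. clinear (\<rho> k x)" and \<sigma>: "\<And>x. clinear (\<sigma> x)"
    and \<rho>xy: "\<And>k f. \<rho> k x (\<rho> k y f) = \<rho> k y (\<rho> k x f)" and \<sigma>xy: "\<And>v. \<sigma> x (\<sigma> y v) = \<sigma> y (\<sigma> x v)"
  shows "tensor_action \<rho> \<sigma> x (tensor_action \<rho> \<sigma> y w) = tensor_action \<rho> \<sigma> y (tensor_action \<rho> \<sigma> x w)"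
proof -
  let ?T = "tensor_action \<rho> \<sigma>"
  have T: "clinear (?T z)" for z
    by (rule clinear_tensor_action) fact+
  have Tp: "?T z (pure_tensor a v) = (\<Sum>i\<in>UNIV. pure_tensor (a(i := \<rho> i z (a i))) v) + pure_tensor a (\<sigma> z v)" for z a v
    by (rule tensor_action_pure) fact+
  have "(\<lambda>w. ?T x (?T y w)) = (\<lambda>w. ?T y (?T x w))"
  proof (rule clinear_tensor_eqI)
    fix a :: "'k \<Rightarrow> 'a" and v :: 'v
    \<comment> \<open>Here \<open>y\<close> acts in slot \<open>i\<close> first and then
      \<open>x\<close> in slot \<open>j\<close>; the two composites differ by exchanging the
      summation indices.\<close>
    let ?u = "\<lambda>x y i j. pure_tensor (a(i := \<rho> i y (a i), j := \<rho> j x ((a(i := \<rho> i y (a i))) j))) v"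
    have "?u x y i j = ?u y x j i" for i j
    proof (cases "i = j")
      case True
      then show ?thesis by (simp add: \<rho>xy)
    next
      case False
      then have "a(i := p, j := q) = a(j := q, i := p)" for p q
        by (rule fun_upd_twist)
      with False show ?thesis by simp
    qed
    then have "(\<Sum>i\<in>UNIV. \<Sum>j\<in>UNIV. ?u x y i j) = (\<Sum>i\<in>UNIV. \<Sum>j\<in>UNIV. ?u y x i j)"
      by (subst sum.swap) simp
    moreover have "?T x (?T y (pure_tensor a v)) =
      (\<Sum>i\<in>UNIV. \<Sum>j\<in>UNIV. ?u x y i j) + (\<Sum>i\<in>UNIV. pure_tensor (a(i := \<rho> i y (a i))) (\<sigma> x v))
      + ((\<Sum>i\<in>UNIV. pure_tensor (a(i := \<rho> i x (a i))) (\<sigma> y v)) + pure_tensor a (\<sigma> x (\<sigma> y v)))" for x y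
      by (simp only: Tp clinear_add[OF T] clinear_sum[OF T] sum.distrib)
    ultimately show "?T x (?T y (pure_tensor a v)) = ?T y (?T x (pure_tensor a v))"
      using \<sigma>xy[of v] by (simp add: add_ac)
  qed (rule clinear_compose[OF T T])+
  then show ?thesis by meson
qed

text \<open>Linear operators on a line commute, so all brackets act as zero, and every generator is
  a nonzero multiple of a bracket.\<close>

lemma one_dim_module_trivial:
  fixes \<sigma> :: "bms \<Rightarrow> 'v \<Rightarrow> 'v::complex_vector" and u :: 'v
  assumes "bms_module \<sigma>" "\<And>v. \<exists>c. v = c *\<^sub>C u" "u \<noteq> 0"
  shows "trivial_one_dim_module \<sigma>"
proof -
  have "complex_vector.span {u} = UNIV"
    using assms(2) unfolding complex_vector.span_singleton by blast
  then have "complex_vector.dim (UNIV :: 'v set) = 1"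
    using complex_vector.dim_eq_card[of "{u}" UNIV] \<open>u \<noteq> 0\<close> by simp
  have lin: "clinear (\<lambda>x. \<sigma> x v)" "clinear (\<sigma> x)"
    and br: "\<sigma> (bracket x y) v = \<sigma> x (\<sigma> y v) - \<sigma> y (\<sigma> x v)" for x y v
    using assms(1) by (auto simp: bms_module_def)
  have comm: "\<sigma> x (\<sigma> y v) = \<sigma> y (\<sigma> x v)" for x y v
  proof -
    obtain a where a: "\<sigma> x u = a *\<^sub>C u" using assms(2) by blast
    obtain b where b: "\<sigma> y u = b *\<^sub>C u" using assms(2) by blast
    obtain c where c: "v = c *\<^sub>C u" using assms(2) by blast
    show ?thesis
      unfolding c by (simp add: a b clinear_scaleC[OF lin(2)] scaleC_scaleC mult_ac)
  qed
  have br0: "\<sigma> (basis_bracket a b) v = 0" for a b v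
    using br[of "gen a" "gen b" v] by (simp add: bracket_def lin_ext_single scaleC_one comm)
  note scale = clinear_scaleC[OF lin(1)] clinear_uminus[OF lin(1)]
  \<comment> \<open>Bracketing with \<open>L 0\<close> reaches every nonzero degree n, with factor
    n; degree 0 is reached by bracketing \<open>L (-1)\<close> with degree 1.\<close>
  have "\<sigma> (gen b) v = 0" for b v
  proof (cases b)
    case (L n)
    then show ?thesis
      using br0[of "L 0" "L n" v] br0[of "L (-1)" "L 1" v] by (cases "n = 0") (simp_all add: scale)
  next
    case (W n)
    then show ?thesis
      using br0[of "L 0" "W n" v] br0[of "L (-1)" "W 1" v] by (cases "n = 0") (simp_all add: scale)
  next
    case (I n)
    then show ?thesis
      using br0[of "L 0" "I n" v] br0[of "L (-1)" "I 1" v] by (cases "n = 0") (simp_all add: scale)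
  next
    case (J n)
    then show ?thesis
      using br0[of "L 0" "J n" v] br0[of "L (-1)" "J 1" v] by (cases "n = 0") (simp_all add: scale)
  qed
  then have "\<sigma> x v = 0" for x v
    using lin_ext_unique[OF lin(1), of v "\<lambda>_. 0" x] by (simp add: lin_ext_def)
  with \<open>complex_vector.dim UNIV = 1\<close> show ?thesis
    by (simp add: trivial_one_dim_module_def)
qed


section \<open>Coinvariants of \<open>L 0\<close> and \<open>W 0\<close>\<close>

lemma clinear_neg: "clinear A \<Longrightarrow> clinear (\<lambda>x. - A x)"
  by (simp add: clinear_iff)

text \<open>\<open>F\<close> substitutes \<open>s\<^sub>i \<mapsto> - L'\<close> and \<open>t\<^sub>i \<mapsto> - W'\<close>, where \<open>L'\<close>, \<open>W'\<close> are the actions of \<open>L\<^sub>0\<close>, \<open>W\<^sub>0\<close>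
  on the remaining tensor factors, obtained by letting the algebra act as \<open>0\<close> on factor \<open>i\<close>.\<close>

lemma coinvariant_projection:
  fixes \<rho> :: "'k::finite \<Rightarrow> bms \<Rightarrow> complex poly poly \<Rightarrow> complex poly poly"
    and \<sigma> :: "bms \<Rightarrow> 'v \<Rightarrow> 'v::complex_vector" and i :: 'k
  assumes \<rho>: "\<And>k x. clinear (\<rho> k x)" and \<sigma>: "\<And>x. clinear (\<sigma> x)"
    and L0: "\<And>k f. \<rho> k (gen (L 0)) f = pCons 0 f"
    and W0: "\<And>k f. \<rho> k (gen (W 0)) f = smult [:0, 1:] f"
    and \<sigma>LW: "\<And>v. \<sigma> (gen (L 0)) (\<sigma> (gen (W 0)) v) = \<sigma> (gen (W 0)) (\<sigma> (gen (L 0)) v)"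
  obtains F :: "('k, complex poly poly, 'v) tensor \<Rightarrow> ('k, complex poly poly, 'v) tensor"
  where "clinear F" "\<And>a v. F (pure_tensor (a(i := 1)) v) = pure_tensor (a(i := 1)) v"
    "\<And>w. F (tensor_action \<rho> \<sigma> (gen (L 0)) w) = 0"
    "\<And>w. F (tensor_action \<rho> \<sigma> (gen (W 0)) w) = 0"
proof -
  let ?l = "gen (L 0)" and ?w = "gen (W 0)"
  define \<rho>' where "\<rho>' k = (if k = i then \<lambda>_ _. 0 else \<rho> k)" for k
  let ?T' = "tensor_action \<rho>' \<sigma>" and ?T = "tensor_action \<rho> \<sigma>"
  have \<rho>': "clinear (\<rho>' k x)" for k x
    using \<rho>[of k x] by (simp add: \<rho>'_def clinear_iff)
  have T': "clinear (?T' x)" for x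
    by (rule clinear_tensor_action[OF \<rho>' \<sigma>])
  have comm: "?T' ?l (?T' ?w u) = ?T' ?w (?T' ?l u)" for u
    by (rule tensor_action_commute[OF \<rho>' \<sigma>]) (simp_all add: \<rho>'_def L0 W0 \<sigma>LW)
  \<comment> \<open>Modulo the image of \<open>L 0\<close>, multiplication by s in factor
    \<open>i\<close> is minus the action on the other factors; likewise for \<open>W 0\<close> and
    t.\<close>
  define A where "A u = - ?T' ?l u" for u
  define B where "B u = - ?T' ?w u" for u
  have "clinear A" "clinear B"
    unfolding A_def [abs_def] B_def [abs_def] by (rule clinear_neg[OF T'])+
  then interpret commuting_ops A B
    by (rule commuting_ops.intro) (simp add: A_def B_def comm clinear_uminus[OF T'])
  \<comment> \<open>Keeping 1 in slot \<open>i\<close> models the tensor product of the remaining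
    factors inside the same type.\<close>
  define g where "g a v = eval_ops A B (a i) (pure_tensor (a(i := 1)) v)" for a v
  have "multilinear g"
    unfolding multilinear_def
  proof (intro conjI allI)
    fix a :: "'k \<Rightarrow> complex poly poly" and k and v :: 'v
    show "clinear (\<lambda>x. g (a(k := x)) v)"
    proof (cases "k = i")
      case True
      then show ?thesis by (simp add: g_def clinear_eval_poly)
    next
      case False
      have "clinear (\<lambda>x. eval_ops A B (a i) (pure_tensor (a(i := 1, k := x)) v))"
        by (rule clinear_compose[OF clinear_eval clinear_pure_slot])
      with False show ?thesis by (simp add: g_def fun_upd_twist)
    qed
    show "clinear (g a)"
      unfolding g_def by (rule clinear_compose[OF clinear_eval clinear_pure_right])
  qed
  then obtain F where F: "clinear F" "\<And>a v. F (pure_tensor a v) = g a v"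
    using tensor_universal by metis
  \<comment> \<open>One computation serves both elements: \<open>C\<close> is \<open>A\<close> for
    \<open>L 0\<close> and \<open>B\<close> for \<open>W 0\<close>.\<close>
  have kill: "F (?T x w) = 0"
    if C: "\<And>u. C u = - ?T' x u"
      "\<And>f u. eval_ops A B (\<rho> i x f) u = C (eval_ops A B f u)"
      "\<And>u. ?T' x (A u) = A (?T' x u)" "\<And>u. ?T' x (B u) = B (?T' x u)" for x C w
  proof -
    have "(\<lambda>w. F (?T x w)) = (\<lambda>w. 0)"
    proof (rule clinear_tensor_eqI)
      show "clinear (\<lambda>w. F (?T x w))"
        by (rule clinear_compose[OF F(1) clinear_tensor_action[OF \<rho> \<sigma>]])
      show "clinear (\<lambda>w::('k, complex poly poly, 'v) tensor. 0 :: ('k, complex poly poly, 'v) tensor)"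
        by (simp add: clinear_iff)
      fix a :: "'k \<Rightarrow> complex poly poly" and v :: 'v
      let ?b = "a(i := 1)" and ?ev = "eval_ops A B (a i)"
      have "F (?T x (pure_tensor a v)) = (\<Sum>k\<in>UNIV. g (a(k := \<rho> k x (a k))) v) + g a (\<sigma> x v)"
        by (simp add: tensor_action_pure[OF \<rho> \<sigma>] clinear_add[OF F(1)] clinear_sum[OF F(1)] F(2))
      also have "(\<Sum>k\<in>UNIV. g (a(k := \<rho> k x (a k))) v) =
        C (g a v) + (\<Sum>k\<in>UNIV - {i}. g (a(k := \<rho> k x (a k))) v)"
        by (subst sum.remove[of UNIV i]) (simp_all add: g_def C(2))
      also have "(\<Sum>k\<in>UNIV - {i}. g (a(k := \<rho> k x (a k))) v) =
        (\<Sum>k\<in>UNIV - {i}. ?ev (pure_tensor (?b(k := \<rho>' k x (?b k))) v))"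
        by (rule sum.cong) (auto simp: g_def \<rho>'_def fun_upd_twist)
      \<comment> \<open>The added term is zero because \<open>\<rho>' i\<close> is zero.\<close>
      also have "\<dots> = (\<Sum>k\<in>UNIV. ?ev (pure_tensor (?b(k := \<rho>' k x (?b k))) v))"
        using clinear_zero[OF clinear_pure_slot[of ?b i v]]
        by (simp add: sum.remove[of UNIV i] \<rho>'_def clinear_zero[OF clinear_eval])
      also have "C (g a v) + \<dots> + g a (\<sigma> x v) = C (g a v) + ?ev (?T' x (pure_tensor ?b v))"
        by (simp add: tensor_action_pure[OF \<rho>' \<sigma>] g_def clinear_add[OF clinear_eval] clinear_sum[OF clinear_eval])
      \<comment> \<open>\<open>?T' x\<close> passes through the polynomial in \<open>A\<close> and
        \<open>B\<close> and yields \<open>- C (g a v)\<close>, which cancels the term from slot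
        \<open>i\<close>.\<close>
      also have "\<dots> = 0"
        by (simp add: eval_commute[OF T' C(3,4)] C(1) g_def)
      finally show "F (?T x (pure_tensor a v)) = 0" .
    qed
    then show ?thesis by meson
  qed
  show ?thesis
  proof
    show "F (?T ?l w) = 0" for w
      by (rule kill[of A ?l]) (simp_all add: A_def B_def L0 eval_s comm clinear_uminus[OF T'])
    show "F (?T ?w w) = 0" for w
      by (rule kill[of B ?w]) (simp_all add: A_def B_def W0 eval_t comm clinear_uminus[OF T'])
    show "F (pure_tensor (a(i := 1)) v) = pure_tensor (a(i := 1)) v" for a v
      by (simp add: F(2) g_def eval_one)
  qed (fact F(1))
qed

text \<open>Splitting off the multiples of s and then those of t leaves the constant term, so the
  class of 1 spans the coinvariants.\<close>

lemma phi_coinvariants: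
  "\<exists>c g q. f = c *\<^sub>C 1 + phi lam \<alpha> \<beta> \<gamma> h (gen (L 0)) g + phi lam \<alpha> \<beta> \<gamma> h (gen (W 0)) q"
proof -
  obtain p g where f: "f = pCons p g" by (cases f)
  obtain c q where p: "p = pCons c q" by (cases p)
  have "f = c *\<^sub>C 1 + pCons 0 g + smult [:0, 1:] [:q:]"
    by (simp add: f p scaleC_poly_poly one_pCons)
  then show ?thesis unfolding phi_L0 phi_W0 by blast
qed

text \<open>Transported along the isomorphism, \<open>phi_coinvariants\<close> shows that the image
  of \<open>F\<close> is spanned by its value at the preimage of 1. The tensors with 1 in slot
  \<open>i\<close> are fixed by \<open>F\<close>, hence lie on that line.\<close>

lemma isomorphic_phi_line:
  fixes \<rho> :: "'k::finite \<Rightarrow> bms \<Rightarrow> complex poly poly \<Rightarrow> complex poly poly"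
    and \<sigma> :: "bms \<Rightarrow> 'v \<Rightarrow> 'v::complex_vector" and i :: 'k
  assumes \<rho>: "\<And>k x. clinear (\<rho> k x)" and \<sigma>: "\<And>x. clinear (\<sigma> x)"
    and L0: "\<And>k f. \<rho> k (gen (L 0)) f = pCons 0 f"
    and W0: "\<And>k f. \<rho> k (gen (W 0)) f = smult [:0, 1:] f"
    and \<sigma>LW: "\<And>v. \<sigma> (gen (L 0)) (\<sigma> (gen (W 0)) v) = \<sigma> (gen (W 0)) (\<sigma> (gen (L 0)) v)"
    and iso: "isomorphic_modules (tensor_action \<rho> \<sigma>) (phi lam' \<alpha>' \<beta>' \<gamma>' h')"
  shows "\<exists>u. \<forall>(a :: 'k \<Rightarrow> complex poly poly) (v :: 'v). \<exists>c. pure_tensor (a(i := 1)) v = c *\<^sub>C u"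
proof -
  let ?T = "tensor_action \<rho> \<sigma>" and ?\<Phi> = "phi lam' \<alpha>' \<beta>' \<gamma>' h'"
  obtain F :: "('k, complex poly poly, 'v) tensor \<Rightarrow> ('k, complex poly poly, 'v) tensor"
    where F: "clinear F" "\<And>a v. F (pure_tensor (a(i := 1)) v) = pure_tensor (a(i := 1)) v"
      "\<And>w. F (?T (gen (L 0)) w) = 0" "\<And>w. F (?T (gen (W 0)) w) = 0"
    using coinvariant_projection[of \<rho> \<sigma> i, OF \<rho> \<sigma> L0 W0 \<sigma>LW] by metis
  obtain \<phi> where \<phi>: "clinear \<phi>" "bij \<phi>" "\<And>x v. \<phi> (?T x v) = ?\<Phi> x (\<phi> v)"
    using iso unfolding isomorphic_modules_def by blast
  have surj: "\<exists>v. \<phi> v = f" for f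
    using \<phi>(2) by (metis bij_pointE)
  obtain u where u: "\<phi> u = 1" using surj by blast
  have "\<exists>c. F w = c *\<^sub>C F u" for w
  proof -
    obtain c g q where "\<phi> w = c *\<^sub>C 1 + ?\<Phi> (gen (L 0)) g + ?\<Phi> (gen (W 0)) q"
      using phi_coinvariants by blast
    moreover obtain g' q' where "\<phi> g' = g" "\<phi> q' = q" using surj by meson
    ultimately have "\<phi> w = \<phi> (c *\<^sub>C u + ?T (gen (L 0)) g' + ?T (gen (W 0)) q')"
      by (simp add: clinear_add[OF \<phi>(1)] clinear_scaleC[OF \<phi>(1)] \<phi>(3) u)
    then have "w = c *\<^sub>C u + ?T (gen (L 0)) g' + ?T (gen (W 0)) q'"
      using bij_is_inj[OF \<phi>(2)] by (simp add: inj_eq)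
    then have "F w = c *\<^sub>C F u"
      by (simp add: clinear_add[OF F(1)] clinear_scaleC[OF F(1)] F(3,4))
    then show ?thesis ..
  qed
  then show ?thesis using F(2) by metis
qed

lemma not_isomorphic_phi:
  fixes \<rho> :: "'k::finite \<Rightarrow> bms \<Rightarrow> complex poly poly \<Rightarrow> complex poly poly"
    and \<sigma> :: "bms \<Rightarrow> 'v \<Rightarrow> 'v::complex_vector" and v :: 'v
  assumes \<rho>: "\<And>k x. clinear (\<rho> k x)"
    and L0: "\<And>k f. \<rho> k (gen (L 0)) f = pCons 0 f"
    and W0: "\<And>k f. \<rho> k (gen (W 0)) f = smult [:0, 1:] f"
    and \<sigma>: "bms_module \<sigma>" and v: "v \<noteq> 0"
    and ne: "\<not> (CARD('k) = 1 \<and> trivial_one_dim_module \<sigma>)"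
  shows "\<not> isomorphic_modules (tensor_action \<rho> \<sigma>) (phi lam' \<alpha>' \<beta>' \<gamma>' h')"
proof
  assume iso: "isomorphic_modules (tensor_action \<rho> \<sigma>) (phi lam' \<alpha>' \<beta>' \<gamma>' h')"
  obtain i :: 'k where True by simp
  have lin: "clinear (\<sigma> x)" "clinear (\<lambda>x. \<sigma> x w)"
    and br: "\<sigma> (bracket x y) w = \<sigma> x (\<sigma> y w) - \<sigma> y (\<sigma> x w)" for x y w
    using \<sigma> by (auto simp: bms_module_def)
  have "bracket (gen (L 0)) (gen (W 0)) = 0"
    by (simp add: bracket_def lin_ext_single)
  then have LW: "\<sigma> (gen (L 0)) (\<sigma> (gen (W 0)) w) = \<sigma> (gen (W 0)) (\<sigma> (gen (L 0)) w)" for w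
    using br[of "gen (L 0)" "gen (W 0)" w] clinear_zero[OF lin(2)] by simp
  obtain u where "\<forall>(a :: 'k \<Rightarrow> complex poly poly) (w :: 'v). \<exists>c. pure_tensor (a(i := 1)) w = c *\<^sub>C u"
    using isomorphic_phi_line[OF \<rho> lin(1) L0 W0 LW iso, of i] by (rule exE)
  note u = this [THEN spec, THEN spec]
  let ?a = "\<lambda>_::'k. 1 :: complex poly poly"
  have a: "?a(i := 1) = ?a" by auto
  \<comment> \<open>The constant slice recovers \<open>w\<close> from 1 \<otimes> w, so a line of
    tensors becomes a line in \<open>'v\<close>.\<close>
  have V: "w = c *\<^sub>C slice i 0 0 u" if "pure_tensor ?a w = c *\<^sub>C u" for w c
    using arg_cong[OF that, of "slice i 0 0"] by (simp add: clinear_scaleC[OF clinear_slice] scaleC_one)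
  obtain c where c: "pure_tensor ?a v = c *\<^sub>C u" using u[of ?a v] unfolding a by blast
  have u0: "slice i 0 0 u \<noteq> 0" using V[OF c] v by auto
  have "\<exists>c. w = c *\<^sub>C slice i 0 0 u" for w
  proof -
    obtain c where "pure_tensor ?a w = c *\<^sub>C u"
      using u[of ?a w] unfolding a by blast
    then have "w = c *\<^sub>C slice i 0 0 u"
      by (rule V)
    then show ?thesis ..
  qed
  then have "trivial_one_dim_module \<sigma>"
    by (rule one_dim_module_trivial[OF \<sigma> _ u0])
  with ne have "CARD('k) \<noteq> card {i}"
    by simp
  then obtain j where j: "j \<noteq> i"
    by (metis UNIV_eq_I singletonI)
  \<comment> \<open>With s in a second factor \<open>j\<close>, this tensor lies on the same line,
    but its constant slice is zero. This forces it to vanish, although its slice of degree 1 in that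
    variable is \<open>v\<close>.\<close>
  let ?b = "?a(j := [:0, 1:])"
  have "?b(i := 1) = ?b" using j by auto
  then have "\<exists>d. pure_tensor ?b v = d *\<^sub>C u"
    using u[of ?b v] by (simp only:)
  then obtain d where d: "pure_tensor ?b v = d *\<^sub>C u"
    by blast
  have "d *\<^sub>C slice i 0 0 u = 0"
    using arg_cong[OF d, of "slice i 0 0"] j
    by (simp add: clinear_scaleC[OF clinear_slice] jet_upd bicoeff_def)
  then have "d = 0" using u0 by simp
  then have "pure_tensor ?b v = 0" using d by simp
  from arg_cong[OF this, of "slice j 1 0"] show False
    using v by (simp add: clinear_zero[OF clinear_slice] jet_upd bicoeff_def)
qed

theorem theorem5p2:
  fixes lam \<alpha> \<beta> \<gamma> :: "'k::finite \<Rightarrow> complex"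
    and h :: "'k \<Rightarrow> complex poly"
    and \<sigma> :: "bms \<Rightarrow> 'v \<Rightarrow> 'v::complex_vector"
    and T :: "bms \<Rightarrow> ('k, complex poly poly, 'v) tensor \<Rightarrow> ('k, complex poly poly, 'v) tensor"
  assumes "\<And>i. lam i \<noteq> 0"
    and "inj lam"
    and "\<And>i. \<alpha> i \<noteq> 0 \<or> \<beta> i \<noteq> 0"
    and "irreducible_module \<sigma>" "restricted_module \<sigma>"
    and "\<not> (CARD('k) = 1 \<and> trivial_one_dim_module \<sigma>)"
    and T_def: "T = tensor_action (\<lambda>i. phi (lam i) (\<alpha> i) (\<beta> i) (\<gamma> i) (h i)) \<sigma>"
  shows "\<not> weight_module T
    \<and> (\<forall>\<tau> :: bms \<Rightarrow> 'u \<Rightarrow> 'u::complex_vector.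
         irreducible_module \<tau> \<and> restricted_module \<tau> \<longrightarrow> \<not> isomorphic_modules T \<tau>)
    \<and> (\<forall>lam' \<alpha>' \<beta>' \<gamma>' h'. lam' \<noteq> 0 \<and> (\<alpha>' \<noteq> 0 \<or> \<beta>' \<noteq> 0) \<longrightarrow>
         \<not> isomorphic_modules T (phi lam' \<alpha>' \<beta>' \<gamma>' h'))"
proof -
  have \<sigma>: "bms_module \<sigma>" "\<And>x. clinear (\<sigma> x)"
    using assms(5) by (auto simp: restricted_module_def bms_module_def)
  obtain v :: 'v where v: "v \<noteq> 0"
    using assms(4) by (auto simp: irreducible_module_def)
  let ?\<rho> = "\<lambda>i. phi (lam i) (\<alpha> i) (\<beta> i) (\<gamma> i) (h i)"
  show ?thesis
    unfolding T_def
  proof (intro conjI allI impI)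
    show "\<not> weight_module (tensor_action ?\<rho> \<sigma>)"
      by (rule not_weight_module[of ?\<rho> \<sigma>, OF clinear_phi phi_L0 \<sigma>(2) v])
    show "\<not> isomorphic_modules (tensor_action ?\<rho> \<sigma>) \<tau>"
      if "irreducible_module \<tau> \<and> restricted_module \<tau>" for \<tau> :: "bms \<Rightarrow> 'u \<Rightarrow> 'u"
      using that by (intro not_isomorphic_restricted[OF assms(1,5) v]) simp
    show "\<not> isomorphic_modules (tensor_action ?\<rho> \<sigma>) (phi lam' \<alpha>' \<beta>' \<gamma>' h')" for lam' \<alpha>' \<beta>' \<gamma>' h'
      by (rule not_isomorphic_phi[of ?\<rho>, OF clinear_phi phi_L0 phi_W0 \<sigma>(1) v assms(6)])
  qed
qed

end
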